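(* Let $v\in\mathbb V$ and let $\xi^\dagger$ be a $\|\cdot\|_{1,\mathbf w}$-minimizing solution of $(\mathbf K\circ\mathbf D)(\xi)=v$. Assume there are $\beta_1,\beta_2,\sigma>0$ and $\rho>\|\xi^\dagger\|_{1,\mathbf w}$ such that $$\|\xi\|_{1,\mathbf w}-\|\xi^\dagger\|_{1,\mathbf w}\ \ge\ \beta_1\|\xi-\xi^\dagger\|-\beta_2\|\mathbf K(\mathbf D(\xi)-\mathbf D(\xi^\dagger))\|$$ for all $\xi\in\ell^2(\Lambda)$ with $\|\xi\|_{1,\mathbf w}<\rho$ and $\|\mathbf K(\mathbf D(\xi)-\mathbf D(\xi^\dagger))\|<\sigma$. For every $\delta>0$ let $v_\delta\in\mathbb V$ satisfy $\|v_\delta-v\|\le\delta$, let $\alpha=\alpha(\delta)>0$, choose $\xi_{\alpha,\delta}\in\arg\min\mathcal S_{\alpha,v_\delta}$, and set $h_{\alpha,\delta}=\|\mathbf K(\mathbf D_{\alpha}(\xi_{\alpha,\delta})-\mathbf D(\xi_{\alpha,\delta}))\|$. Suppose that $$\alpha(\delta)\asymp\delta,\qquad h_{\alpha,\delta}\asymp\delta,\qquad \Delta_\rho(\alpha(\delta))\asymp\delta .$$ Then the following hold (as $\delta\to 0$): (a) $\|\xi_{\alpha,\delta}-\xi^\dagger\|=\mathcal O(\delta)$. (b) Assume that $\mathbf D_\alpha$ is Lipschitz, and set $u_{\alpha,\delta}=\mathbf D_{\alpha}(\xi_{\alpha,\delta})$, $u^\dagger=\mathbf D(\xi^\dagger)$.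 Then $\|u_{\alpha,\delta}-u^\dagger\|=\mathcal O(\delta)$.
   Context: Setting and standing assumptions: $\mathbb U$ and $\mathbb V$ are Hilbert spaces; $\mathbf K \colon \mathbb U \to \mathbb V$ is linear and bounded; $\Lambda$ is an at most countable set; $\mathbf D \colon \ell^2(\Lambda)\to\mathbb U$ and $\mathbf D_\alpha \colon \ell^2(\Lambda) \to \mathbb U$ for $\alpha>0$ are given (possibly non-linear) maps; for every $\alpha>0$ the map $\mathbf D_\alpha$ is weakly sequentially continuous; $\mathbf w = (w_\lambda)_{\lambda\in\Lambda} \in (0,\infty)^\Lambda$ satisfies $\inf_{\lambda\in\Lambda} w_\lambda > 0$. Moreover, for every $\rho>0$, $$\Delta_\rho(\alpha) = \sup_{\|\xi\|_{\ell^2(\Lambda)}\le\rho}\|\mathbf D_\alpha(\xi)-\mathbf D(\xi)\|_{\mathbb U} \to 0 \quad\text{as } \alpha\to 0.$$ The weighted $\ell^1$-norm is $\|\xi\|_{1,\mathbf w} = \sum_{\lambda\in\Lambda} w_\lambda |\xi_\lambda| \in [0,\infty]$ for $\xi\in\ell^2(\Lambda)$; unsubscripted norms are those of $\ell^2(\Lambda)$, $\mathbb U$ or $\mathbb V$. For $\alpha>0$ and $v \in \mathbb V$ the deep synthesis functional is $$\mathcal S_{\alpha,v}(\xi) = \|(\mathbf K\circ \mathbf D_\alpha)(\xi) - v\|_{\mathbb V}^2 + \alpha \|\xi\|_{1,\mathbf w},\qquad \xi\in\ell^2(\Lambda).$$ A $\|\cdot\|_{1,\mathbf w}$-minimizing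 solution of $(\mathbf K\circ\mathbf D)(\xi)=v$ is an element of $\arg\min\{\|\xi\|_{1,\mathbf w} \mid (\mathbf K\circ\mathbf D)(\xi)=v\}$. For a quantity $f(\delta)$ depending on $\delta>0$, $f\asymp\delta$ means that there are constants $C_1,C_2>0$ with $C_1\delta\le f(\delta)\le C_2\delta$ for $\delta>0$.
   Formalization: The formal theorem additionally assumes ‖ξ†‖ ≤ ρ in ℓ² (automatic if inf w ≥ 1), and in (b) takes the maps D_α to be Lipschitz with one constant common to all α > 0; without these the claims (a) and (b) fail. *)

theory Defs
  imports "HOL-Analysis.Analysis" "HOL-Library.Landau_Symbols"
begin

section \<open>The space of square-summable families\<close>

text \<open>
  The index set is the universe of the type \<open>'i\<close>. The scalars \<open>'k\<close> are kept abstract,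
  so that real and complex sequence spaces are both covered. As usual in this library, a complex
  Hilbert space is treated as a real one, with the real part of its inner product; norms, bounded
  linear maps and weak convergence are unaffected by this.
\<close>

typedef (overloaded) ('i, 'k::real_inner) ell2 =
  "{x :: 'i \<Rightarrow> 'k. (\<lambda>i. (norm (x i))\<^sup>2) summable_on UNIV}"
  morphisms coord Abs_ell2
  by (rule exI[of _ "\<lambda>_. 0"]) simp

setup_lifting type_definition_ell2

lemma summable_coord: "(\<lambda>i. (norm (coord x i))\<^sup>2) summable_on UNIV"
  using coord[of x] by simp

lemma ell2_eqI: "(\<And>i. coord x i = coord y i) \<Longrightarrow> x = y"
  by (metis coord_inject ext)

lemma square_summable_add:
  fixes x y :: "'i \<Rightarrow> 'k::real_inner"
  assumes "(\<lambda>i. (norm (x i))\<^sup>2) summable_on UNIV" "(\<lambda>i. (norm (y i))\<^sup>2) summable_on UNIV"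
  shows "(\<lambda>i. (norm (x i + y i))\<^sup>2) summable_on UNIV"
proof (rule summable_on_comparison_test)
  show "(\<lambda>i. 2 * ((norm (x i))\<^sup>2 + (norm (y i))\<^sup>2)) summable_on UNIV"
    by (intro summable_on_cmult_right summable_on_add assms)
  show "(norm (x i + y i))\<^sup>2 \<le> 2 * ((norm (x i))\<^sup>2 + (norm (y i))\<^sup>2)" for i
  proof -
    have "(norm (x i + y i))\<^sup>2 \<le> (norm (x i) + norm (y i))\<^sup>2"
      by (intro power_mono norm_triangle_ineq) simp
    also have "\<dots> \<le> 2 * ((norm (x i))\<^sup>2 + (norm (y i))\<^sup>2)"
      using sum_squares_bound[of "norm (x i)" "norm (y i)"] by (simp add: power2_sum)
    finally show ?thesis .
  qed
qed simp

lemma square_summable_scaleR: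
  fixes x :: "'i \<Rightarrow> 'k::real_inner"
  assumes "(\<lambda>i. (norm (x i))\<^sup>2) summable_on UNIV"
  shows "(\<lambda>i. (norm (c *\<^sub>R x i))\<^sup>2) summable_on UNIV"
  using summable_on_cmult_right[OF assms, of "c\<^sup>2"] by (simp add: power_mult_distrib)

instantiation ell2 :: (type, real_inner) real_vector
begin

lift_definition zero_ell2 :: "('a, 'b) ell2" is "\<lambda>_. 0" by simp
lift_definition plus_ell2 :: "('a, 'b) ell2 \<Rightarrow> ('a, 'b) ell2 \<Rightarrow> ('a, 'b) ell2"
  is "\<lambda>x y i. x i + y i" by (rule square_summable_add)
lift_definition uminus_ell2 :: "('a, 'b) ell2 \<Rightarrow> ('a, 'b) ell2"
  is "\<lambda>x i. - x i" by simp
lift_definition minus_ell2 :: "('a, 'b) ell2 \<Rightarrow> ('a, 'b) ell2 \<Rightarrow> ('a, 'b) ell2"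
  is "\<lambda>x y i. x i - y i"
  using square_summable_add[where y = "\<lambda>i. - y i" for y] by simp
lift_definition scaleR_ell2 :: "real \<Rightarrow> ('a, 'b) ell2 \<Rightarrow> ('a, 'b) ell2"
  is "\<lambda>c x i. c *\<^sub>R x i" by (rule square_summable_scaleR)

instance
  by standard (transfer; simp add: algebra_simps)+

end

lemmas coord_simps [simp] =
  zero_ell2.rep_eq plus_ell2.rep_eq uminus_ell2.rep_eq minus_ell2.rep_eq scaleR_ell2.rep_eq

lemma summable_inner_coord:
  "(\<lambda>i. inner (coord x i) (coord y i)) summable_on UNIV"
proof (rule abs_summable_summable, rule summable_on_comparison_test)
  show "(\<lambda>i. (norm (coord x i))\<^sup>2 + (norm (coord y i))\<^sup>2) summable_on UNIV"
    by (intro summable_on_add summable_coord)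
  show "norm (inner (coord x i) (coord y i)) \<le> (norm (coord x i))\<^sup>2 + (norm (coord y i))\<^sup>2" for i
  proof -
    have "\<bar>inner (coord x i) (coord y i)\<bar> \<le> norm (coord x i) * norm (coord y i)"
      by (rule Cauchy_Schwarz_ineq2)
    also have "\<dots> \<le> (norm (coord x i))\<^sup>2 + (norm (coord y i))\<^sup>2"
      using sum_squares_bound[of "norm (coord x i)" "norm (coord y i)"]
        mult_nonneg_nonneg[OF norm_ge_zero norm_ge_zero, of "coord x i" "coord y i"]
      unfolding mult.assoc by linarith
    finally show ?thesis by simp
  qed
qed simp

instantiation ell2 :: (type, real_inner) real_inner
begin

definition inner_ell2 :: "('a, 'b) ell2 \<Rightarrow> ('a, 'b) ell2 \<Rightarrow> real"
  where "inner_ell2 x y = (\<Sum>\<^sub>\<infinity>i. inner (coord x i) (coord y i))"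
definition norm_ell2 :: "('a, 'b) ell2 \<Rightarrow> real"
  where "norm_ell2 x = sqrt (\<Sum>\<^sub>\<infinity>i. (norm (coord x i))\<^sup>2)"
definition dist_ell2 :: "('a, 'b) ell2 \<Rightarrow> ('a, 'b) ell2 \<Rightarrow> real"
  where "dist_ell2 x y = norm (x - y)"
definition sgn_ell2 :: "('a, 'b) ell2 \<Rightarrow> ('a, 'b) ell2"
  where "sgn_ell2 x = inverse (norm x) *\<^sub>R x"
definition uniformity_ell2 :: "(('a, 'b) ell2 \<times> ('a, 'b) ell2) filter"
  where "uniformity_ell2 = (INF e\<in>{0 <..}. principal {(x, y). dist x y < e})"
definition open_ell2 :: "('a, 'b) ell2 set \<Rightarrow> bool"
  where "open_ell2 S = (\<forall>x\<in>S. \<forall>\<^sub>F (x', y) in uniformity. x' = x \<longrightarrow> y \<in> S)"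

instance
proof
  fix x y z :: "('a, 'b) ell2" and r :: real
  show "dist x y = norm (x - y)" by (rule dist_ell2_def)
  show "sgn x = x /\<^sub>R norm x" by (rule sgn_ell2_def)
  show "uniformity = (INF e\<in>{0 <..}. principal {(x::('a, 'b) ell2, y). dist x y < e})"
    by (rule uniformity_ell2_def)
  show "open U = (\<forall>x\<in>U. \<forall>\<^sub>F (x', y) in uniformity. x' = x \<longrightarrow> y \<in> U)"
    for U :: "('a, 'b) ell2 set" by (rule open_ell2_def)
  show "inner x y = inner y x"
    by (simp add: inner_ell2_def inner_commute)
  show "inner (x + y) z = inner x z + inner y z"
    by (simp add: inner_ell2_def inner_add_left infsum_add summable_inner_coord)
  show "inner (r *\<^sub>R x) y = r * inner x y"
    by (simp add: inner_ell2_def infsum_cmult_right summable_inner_coord)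
  show "0 \<le> inner x x"
    by (simp add: inner_ell2_def infsum_nonneg)
  show "inner x x = 0 \<longleftrightarrow> x = 0"
  proof
    assume *: "inner x x = 0"
    have "inner (coord x i) (coord x i) = 0" for i
      by (rule nonneg_infsum_le_0D[where A = UNIV and f = "\<lambda>i. inner (coord x i) (coord x i)"])
        (use * in \<open>simp_all add: inner_ell2_def summable_inner_coord\<close>)
    then show "x = 0" by (intro ell2_eqI) simp
  qed (simp add: inner_ell2_def)
  show "norm x = sqrt (inner x x)"
    by (simp add: inner_ell2_def norm_ell2_def power2_norm_eq_inner)
qed

end

section \<open>Weak sequential continuity\<close>

definition weakly_converges :: "(nat \<Rightarrow> 'a::real_normed_vector) \<Rightarrow> 'a \<Rightarrow> bool" where
  "weakly_converges x l \<longleftrightarrow> (\<forall>f :: 'a \<Rightarrow> real. bounded_linear f \<longrightarrow> (\<lambda>n. f (x n)) \<longlonglongrightarrow> f l)"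

definition weakly_seq_continuous ::
    "('a::real_normed_vector \<Rightarrow> 'b::real_normed_vector) \<Rightarrow> bool" where
  "weakly_seq_continuous F \<longleftrightarrow>
     (\<forall>x l. weakly_converges x l \<longrightarrow> weakly_converges (\<lambda>n. F (x n)) (F l))"

section \<open>Deep synthesis regularization\<close>

text \<open>
  For positive weights all terms are nonnegative, so the sum always exists in the extended reals
  and is infinite exactly when the weighted family is not absolutely summable.
\<close>

definition wnorm1 :: "('i \<Rightarrow> real) \<Rightarrow> ('i, 'k::real_inner) ell2 \<Rightarrow> ereal" where
  "wnorm1 w \<xi> = (\<Sum>\<^sub>\<infinity>i. ereal (w i * norm (coord \<xi> i)))"

definition deep_synthesis ::
    "('u \<Rightarrow> 'v::real_normed_vector) \<Rightarrow> (real \<Rightarrow> ('i, 'k::real_inner) ell2 \<Rightarrow> 'u) \<Rightarrow>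
     ('i \<Rightarrow> real) \<Rightarrow> real \<Rightarrow> 'v \<Rightarrow> ('i, 'k) ell2 \<Rightarrow> ereal" where
  "deep_synthesis K D\<alpha> w \<alpha> v \<xi> =
     ereal ((norm ((K \<circ> D\<alpha> \<alpha>) \<xi> - v))\<^sup>2) + ereal \<alpha> * wnorm1 w \<xi>"

definition wnorm1_minimizing_solution ::
    "('i \<Rightarrow> real) \<Rightarrow> (('i, 'k::real_inner) ell2 \<Rightarrow> 'v) \<Rightarrow> 'v \<Rightarrow> ('i, 'k) ell2 \<Rightarrow> bool" where
  "wnorm1_minimizing_solution w F v \<xi> \<longleftrightarrow> is_arg_min (wnorm1 w) (\<lambda>\<xi>. F \<xi> = v) \<xi>"

text \<open>The supremum is taken in the extended reals, since it may be infinite for some \<open>\<alpha>\<close>.\<close>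

definition Delta ::
    "('a::real_normed_vector \<Rightarrow> 'u::real_normed_vector) \<Rightarrow> (real \<Rightarrow> 'a \<Rightarrow> 'u) \<Rightarrow>
     real \<Rightarrow> real \<Rightarrow> ereal" where
  "Delta D D\<alpha> \<rho> \<alpha> = (SUP \<xi>\<in>{\<xi>. norm \<xi> \<le> \<rho>}. ereal (norm (D\<alpha> \<alpha> \<xi> - D \<xi>)))"

definition asymp_delta :: "(real \<Rightarrow> ereal) \<Rightarrow> bool" where
  "asymp_delta f \<longleftrightarrow>
     (\<exists>C1>0. \<exists>C2>0. \<forall>\<delta>>0. ereal (C1 * \<delta>) \<le> f \<delta> \<and> f \<delta> \<le> ereal (C2 * \<delta>))"

end

theory Submission
  imports Defs
begin

text \<open>
  The proof is the usual variational argument: the minimizer \<open>\<xi>s \<delta>\<close> is compared with the exact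
  solution \<open>\<xi>\<^sub>0\<close> in the functional with data \<open>v\<delta>\<close>. The residual of \<open>\<xi>\<^sub>0\<close> there is \<open>O(\<delta>)\<close>, since
  \<open>Delta D D\<alpha> \<rho> (\<alpha> \<delta>)\<close> and the noise are. As \<open>\<alpha> \<delta>\<close> is of order \<open>\<delta>\<close>, minimality then shows that the
  penalty of \<open>\<xi>s \<delta>\<close> exceeds that of \<open>\<xi>\<^sub>0\<close> by at most \<open>O(\<delta>)\<close> and that the residual \<open>r\<close> of
  \<open>\<xi>s \<delta>\<close> tends to \<open>0\<close>, so for small \<open>\<delta>\<close> the source condition applies at \<open>\<xi>s \<delta>\<close>. Inserting it into
  the minimality inequality gives
  \<open>r\<^sup>2 + \<alpha> \<delta> * (\<beta>1 * norm (\<xi>s \<delta> - \<xi>\<^sub>0) - \<beta>2 * (r + O(\<delta>))) \<le> O(\<delta>\<^sup>2)\<close>,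
  and completing the square in \<open>r\<close> absorbs the term \<open>\<alpha> \<delta> * \<beta>2 * r\<close> at the cost of
  \<open>(\<alpha> \<delta> * \<beta>2)\<^sup>2 / 4 = O(\<delta>\<^sup>2)\<close> (lemma \<open>error_bound_from_source_inequality\<close>);
  dividing by \<open>\<alpha> \<delta>\<close> yields the rate for the coefficients. The rate for \<open>D\<alpha> (\<alpha> \<delta>) (\<xi>s \<delta>)\<close> follows from
  a Lipschitz constant that is common to all \<open>D\<alpha> a\<close>, together with the \<open>O(\<delta>)\<close> distance of
  \<open>D\<alpha> (\<alpha> \<delta>) \<xi>\<^sub>0\<close> to \<open>D \<xi>\<^sub>0\<close>.
\<close>

lemma wnorm1_nonneg:
  assumes "\<And>i. w i \<ge> 0"
  shows "wnorm1 w \<xi> \<ge> 0"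
  unfolding wnorm1_def using assms by (intro infsum_nonneg) simp

lemma norm_le_Delta:
  assumes "norm \<xi> \<le> \<rho>"
  shows "ereal (norm (D\<alpha> a \<xi> - D \<xi>)) \<le> Delta D D\<alpha> \<rho> a"
  unfolding Delta_def using assms by (intro SUP_upper) simp

lemma deep_synthesis_minimizer_penalty_finite:
  assumes min: "is_arg_min (deep_synthesis K D\<alpha> w a y) (\<lambda>_. True) \<xi>"
    and a: "a > 0" and w: "\<And>i. w i \<ge> 0"
    and \<eta>: "wnorm1 w \<eta> = ereal p"
  obtains q where "wnorm1 w \<xi> = ereal q" "q \<ge> 0"
    "(norm (K (D\<alpha> a \<xi>) - y))\<^sup>2 + a * q \<le> (norm (K (D\<alpha> a \<eta>) - y))\<^sup>2 + a * p"
proof -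
  have le: "deep_synthesis K D\<alpha> w a y \<xi> \<le> deep_synthesis K D\<alpha> w a y \<eta>"
    using min by (simp add: is_arg_min_linorder)
  have nonneg: "wnorm1 w \<xi> \<ge> 0" by (rule wnorm1_nonneg) (rule w)
  show thesis
  proof (cases "wnorm1 w \<xi>")
    case (real q)
    then show thesis using le nonneg \<eta> by (intro that[of q]) (auto simp: deep_synthesis_def)
  next
    case PInf
    then show thesis using le \<eta> a by (simp add: deep_synthesis_def)
  next
    case MInf
    then show thesis using nonneg by simp
  qed
qed

text \<open>
  Here \<open>r\<close> and \<open>s\<close> are the residuals of the minimizer and of the exact solution, \<open>n\<close> and \<open>n\<^sub>0\<close> their
  penalties, \<open>e\<close> the norm distance of the two, and \<open>h + r + \<delta>\<close> the bound on their distance in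
  data space.
\<close>

lemma error_bound_from_source_inequality:
  fixes r s a n n\<^sub>0 e h \<delta> \<beta>1 \<beta>2 :: real
  assumes min: "r\<^sup>2 + a * n \<le> s\<^sup>2 + a * n\<^sub>0"
    and source: "\<beta>1 * e - \<beta>2 * (h + r + \<delta>) \<le> n - n\<^sub>0"
    and a: "a \<ge> 0"
  shows "a * \<beta>1 * e \<le> s\<^sup>2 + a * \<beta>2 * (h + \<delta>) + (a * \<beta>2)\<^sup>2 / 4"
proof -
  have "a * (\<beta>1 * e - \<beta>2 * (h + r + \<delta>)) \<le> a * (n - n\<^sub>0)"
    using source a by (rule mult_left_mono)
  moreover have "0 \<le> (r - a * \<beta>2 / 2)\<^sup>2" by simp
  ultimately show ?thesis using min by (simp add: power2_eq_square field_simps)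
qed

theorem theorem2p9:
  fixes K :: "'u::{real_inner, complete_space} \<Rightarrow> 'v::{real_inner, complete_space}"
    and D :: "('i::countable, 'k::{real_normed_field, real_inner}) ell2 \<Rightarrow> 'u"
    and D\<alpha> :: "real \<Rightarrow> ('i, 'k) ell2 \<Rightarrow> 'u"
    and w :: "'i \<Rightarrow> real"
    and v :: 'v and v\<delta> :: "real \<Rightarrow> 'v"
    and \<xi>\<^sub>0 :: "('i, 'k) ell2" and \<xi>s :: "real \<Rightarrow> ('i, 'k) ell2"
    and \<alpha> :: "real \<Rightarrow> real"
    and \<beta>1 \<beta>2 \<sigma> \<rho> :: real
  assumes K: "bounded_linear K"
    and D\<alpha>: "\<And>a. a > 0 \<Longrightarrow> weakly_seq_continuous (D\<alpha> a)"
    and w_pos: "\<And>i. w i > 0"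
    and w_inf: "(INF i. w i) > 0"
    and Delta_lim: "\<And>r. r > 0 \<Longrightarrow> ((\<lambda>a. Delta D D\<alpha> r a) \<longlongrightarrow> 0) (at_right 0)"
    and sol: "wnorm1_minimizing_solution w (K \<circ> D) v \<xi>\<^sub>0"
    and pos: "\<beta>1 > 0" "\<beta>2 > 0" "\<sigma> > 0"
    and \<rho>: "wnorm1 w \<xi>\<^sub>0 < ereal \<rho>"
    and \<rho>_ell2: "norm \<xi>\<^sub>0 \<le> \<rho>"
    and source: "\<And>\<xi>. wnorm1 w \<xi> < ereal \<rho> \<Longrightarrow> norm (K (D \<xi> - D \<xi>\<^sub>0)) < \<sigma> \<Longrightarrow>
        wnorm1 w \<xi> - wnorm1 w \<xi>\<^sub>0 \<ge>
          ereal (\<beta>1 * norm (\<xi> - \<xi>\<^sub>0) - \<beta>2 * norm (K (D \<xi> - D \<xi>\<^sub>0)))"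
    and data: "\<And>\<delta>. \<delta> > 0 \<Longrightarrow> norm (v\<delta> \<delta> - v) \<le> \<delta>"
    and \<alpha>_pos: "\<And>\<delta>. \<delta> > 0 \<Longrightarrow> \<alpha> \<delta> > 0"
    and minimizer: "\<And>\<delta>. \<delta> > 0 \<Longrightarrow>
        is_arg_min (deep_synthesis K D\<alpha> w (\<alpha> \<delta>) (v\<delta> \<delta>)) (\<lambda>_. True) (\<xi>s \<delta>)"
    and \<alpha>_asymp: "asymp_delta (\<lambda>\<delta>. ereal (\<alpha> \<delta>))"
    and h_asymp: "asymp_delta (\<lambda>\<delta>. ereal (norm (K (D\<alpha> (\<alpha> \<delta>) (\<xi>s \<delta>) - D (\<xi>s \<delta>)))))"
    and Delta_asymp: "asymp_delta (\<lambda>\<delta>. Delta D D\<alpha> \<rho> (\<alpha> \<delta>))"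
  shows "(\<lambda>\<delta>. norm (\<xi>s \<delta> - \<xi>\<^sub>0)) \<in> O[at_right 0](\<lambda>\<delta>. \<delta>) \<and>
    ((\<exists>L. \<forall>a>0. L-lipschitz_on UNIV (D\<alpha> a)) \<longrightarrow>
      (\<lambda>\<delta>. norm (D\<alpha> (\<alpha> \<delta>) (\<xi>s \<delta>) - D \<xi>\<^sub>0)) \<in> O[at_right 0](\<lambda>\<delta>. \<delta>))"
proof -
  obtain c1 c2 where c: "c1 > 0" "c2 > 0"
    and \<alpha>_bounds: "\<And>\<delta>. \<delta> > 0 \<Longrightarrow> c1 * \<delta> \<le> \<alpha> \<delta> \<and> \<alpha> \<delta> \<le> c2 * \<delta>"
    using \<alpha>_asymp unfolding asymp_delta_def by auto
  define h where "h \<delta> = norm (K (D\<alpha> (\<alpha> \<delta>) (\<xi>s \<delta>) - D (\<xi>s \<delta>)))" for \<delta>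
  obtain H where H: "H > 0" and h_le: "\<And>\<delta>. \<delta> > 0 \<Longrightarrow> h \<delta> \<le> H * \<delta>"
    using h_asymp unfolding asymp_delta_def h_def by auto
  obtain C where C: "C > 0"
    and Delta_le: "\<And>\<delta>. \<delta> > 0 \<Longrightarrow> Delta D D\<alpha> \<rho> (\<alpha> \<delta>) \<le> ereal (C * \<delta>)"
    using Delta_asymp unfolding asymp_delta_def by auto
  obtain M where M: "M > 0" and K_le: "\<And>x. norm (K x) \<le> norm x * M"
    using bounded_linear.pos_bounded[OF K] by auto
  have K_diff: "K (x - y) = K x - K y" for x y
    using K by (simp add: bounded_linear.linear linear_diff)
  have w_nonneg: "w i \<ge> 0" for i using w_pos[of i] by simp
  have sol_eq: "K (D \<xi>\<^sub>0) = v"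
    using sol by (simp add: wnorm1_minimizing_solution_def is_arg_min_def)
  have "wnorm1 w \<xi>\<^sub>0 \<ge> 0" by (rule wnorm1_nonneg) (rule w_nonneg)
  with \<rho> obtain n\<^sub>0 where n\<^sub>0: "wnorm1 w \<xi>\<^sub>0 = ereal n\<^sub>0" "n\<^sub>0 \<ge> 0" "n\<^sub>0 < \<rho>"
    by (cases "wnorm1 w \<xi>\<^sub>0") auto
  have synth_sol: "norm (D\<alpha> (\<alpha> \<delta>) \<xi>\<^sub>0 - D \<xi>\<^sub>0) \<le> C * \<delta>" if "\<delta> > 0" for \<delta>
    using order_trans[OF norm_le_Delta[OF \<rho>_ell2] Delta_le[OF that]] by simp
  define A where "A = M * C + 1"
  have residual_sol: "(norm (K (D\<alpha> (\<alpha> \<delta>) \<xi>\<^sub>0) - v\<delta> \<delta>))\<^sup>2 \<le> (A * \<delta>)\<^sup>2" if \<delta>: "\<delta> > 0" for \<delta>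
  proof -
    have "K (D\<alpha> (\<alpha> \<delta>) \<xi>\<^sub>0) - v\<delta> \<delta> = K (D\<alpha> (\<alpha> \<delta>) \<xi>\<^sub>0 - D \<xi>\<^sub>0) - (v\<delta> \<delta> - v)"
      by (simp add: K_diff sol_eq)
    also have "norm \<dots> \<le> norm (K (D\<alpha> (\<alpha> \<delta>) \<xi>\<^sub>0 - D \<xi>\<^sub>0)) + norm (v\<delta> \<delta> - v)"
      by (rule norm_triangle_ineq4)
    also have "\<dots> \<le> norm (D\<alpha> (\<alpha> \<delta>) \<xi>\<^sub>0 - D \<xi>\<^sub>0) * M + \<delta>"
      by (intro add_mono K_le data \<delta>)
    also have "\<dots> \<le> A * \<delta>"
      using mult_right_mono[OF synth_sol[OF \<delta>], of M] M by (simp add: A_def algebra_simps)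
    finally show ?thesis by (intro power_mono) simp_all
  qed

  \<comment> \<open>Smallness of \<open>\<delta>\<close> needed for the source condition to apply at \<open>\<xi>s \<delta>\<close>: the two left-hand
      sides bound \<open>wnorm1 w (\<xi>s \<delta>)\<close> and \<open>norm (K (D (\<xi>s \<delta>) - D \<xi>\<^sub>0))\<close> from above.\<close>
  have "((\<lambda>\<delta>. n\<^sub>0 + A\<^sup>2 * \<delta> / c1) \<longlongrightarrow> n\<^sub>0) (at_right 0)"
    by (auto intro!: tendsto_eq_intros simp: c less_imp_neq[OF c(1), symmetric])
  then have small1: "\<forall>\<^sub>F \<delta> in at_right 0. n\<^sub>0 + A\<^sup>2 * \<delta> / c1 < \<rho>"
    using n\<^sub>0(3) by (rule order_tendstoD)
  have "((\<lambda>\<delta>. H * \<delta> + sqrt ((A * \<delta>)\<^sup>2 + c2 * \<delta> * n\<^sub>0) + \<delta>) \<longlongrightarrow> 0) (at_right 0)"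
    by (auto intro!: tendsto_eq_intros)
  then have small2: "\<forall>\<^sub>F \<delta> in at_right 0. H * \<delta> + sqrt ((A * \<delta>)\<^sup>2 + c2 * \<delta> * n\<^sub>0) + \<delta> < \<sigma>"
    using pos(3) by (rule order_tendstoD)

  define B where "B = (A\<^sup>2 + c2 * \<beta>2 * (H + 1) + (c2 * \<beta>2)\<^sup>2 / 4) / (c1 * \<beta>1)"
  have rate: "\<forall>\<^sub>F \<delta> in at_right 0. norm (\<xi>s \<delta> - \<xi>\<^sub>0) \<le> B * \<delta>"
    using small1 small2 eventually_at_right_less
  proof eventually_elim
    case (elim \<delta>)
    have \<delta>: "\<delta> > 0" using elim by simp
    define r where "r = norm (K (D\<alpha> (\<alpha> \<delta>) (\<xi>s \<delta>)) - v\<delta> \<delta>)"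
    obtain n where n: "wnorm1 w (\<xi>s \<delta>) = ereal n" "n \<ge> 0"
      and "r\<^sup>2 + \<alpha> \<delta> * n \<le> (norm (K (D\<alpha> (\<alpha> \<delta>) \<xi>\<^sub>0) - v\<delta> \<delta>))\<^sup>2 + \<alpha> \<delta> * n\<^sub>0"
      using deep_synthesis_minimizer_penalty_finite[OF minimizer[OF \<delta>] \<alpha>_pos[OF \<delta>] w_nonneg n\<^sub>0(1)]
      unfolding r_def by blast
    with residual_sol[OF \<delta>] have min: "r\<^sup>2 + \<alpha> \<delta> * n \<le> (A * \<delta>)\<^sup>2 + \<alpha> \<delta> * n\<^sub>0" by linarith
    note \<alpha>_pos' = \<alpha>_pos[OF \<delta>] and lo = \<alpha>_bounds[OF \<delta>, THEN conjunct1]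
      and hi = \<alpha>_bounds[OF \<delta>, THEN conjunct2]

    have "n \<le> n\<^sub>0 + A\<^sup>2 * \<delta> / c1"
    proof -
      have "\<alpha> \<delta> * (n - n\<^sub>0) \<le> (A * \<delta>)\<^sup>2"
        using min zero_le_power2[of r] unfolding right_diff_distrib by linarith
      then have "n - n\<^sub>0 \<le> (A * \<delta>)\<^sup>2 / \<alpha> \<delta>"
        using \<alpha>_pos' by (simp add: pos_le_divide_eq mult.commute)
      also have "\<dots> \<le> (A * \<delta>)\<^sup>2 / (c1 * \<delta>)"
        using lo c \<delta> \<alpha>_pos' by (intro divide_left_mono) auto
      also have "\<dots> = A\<^sup>2 * \<delta> / c1" using \<delta> by (simp add: power2_eq_square)
      finally show ?thesis by simp
    qed
    with elim(1) have penalty: "wnorm1 w (\<xi>s \<delta>) < ereal \<rho>" by (simp add: n)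

    have "\<alpha> \<delta> * n\<^sub>0 \<le> c2 * \<delta> * n\<^sub>0" using hi n\<^sub>0(2) by (rule mult_right_mono)
    moreover have "\<alpha> \<delta> * n \<ge> 0" using \<alpha>_pos' n(2) by simp
    ultimately have "r\<^sup>2 \<le> (A * \<delta>)\<^sup>2 + c2 * \<delta> * n\<^sub>0" using min by linarith
    then have r_le: "r \<le> sqrt ((A * \<delta>)\<^sup>2 + c2 * \<delta> * n\<^sub>0)" by (rule real_le_rsqrt)
    have "K (D (\<xi>s \<delta>) - D \<xi>\<^sub>0) = - K (D\<alpha> (\<alpha> \<delta>) (\<xi>s \<delta>) - D (\<xi>s \<delta>))
        + (K (D\<alpha> (\<alpha> \<delta>) (\<xi>s \<delta>)) - v\<delta> \<delta>) + (v\<delta> \<delta> - v)"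
      by (simp add: K_diff sol_eq)
    also have "norm \<dots> \<le> h \<delta> + r + norm (v\<delta> \<delta> - v)"
      unfolding h_def r_def
      by (intro norm_triangle_mono) simp_all
    finally have data_dist: "norm (K (D (\<xi>s \<delta>) - D \<xi>\<^sub>0)) \<le> h \<delta> + r + \<delta>"
      using data[OF \<delta>] by linarith
    have "norm (K (D (\<xi>s \<delta>) - D \<xi>\<^sub>0)) < \<sigma>"
      using data_dist h_le[OF \<delta>] r_le elim(2) by linarith
    from source[OF penalty this]
    have "\<beta>1 * norm (\<xi>s \<delta> - \<xi>\<^sub>0) - \<beta>2 * norm (K (D (\<xi>s \<delta>) - D \<xi>\<^sub>0)) \<le> n - n\<^sub>0"
      by (simp add: n n\<^sub>0)
    with mult_left_mono[OF data_dist, of \<beta>2] pos(2)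
    have "\<beta>1 * norm (\<xi>s \<delta> - \<xi>\<^sub>0) - \<beta>2 * (h \<delta> + r + \<delta>) \<le> n - n\<^sub>0" by linarith
    from error_bound_from_source_inequality[OF min this less_imp_le[OF \<alpha>_pos']]
    have est: "\<alpha> \<delta> * \<beta>1 * norm (\<xi>s \<delta> - \<xi>\<^sub>0)
        \<le> (A * \<delta>)\<^sup>2 + \<alpha> \<delta> * \<beta>2 * (h \<delta> + \<delta>) + (\<alpha> \<delta> * \<beta>2)\<^sup>2 / 4" .
    have "c1 * \<delta> * \<beta>1 * norm (\<xi>s \<delta> - \<xi>\<^sub>0) \<le> \<alpha> \<delta> * \<beta>1 * norm (\<xi>s \<delta> - \<xi>\<^sub>0)"
      using lo pos by (intro mult_right_mono) auto
    also note est
    also have "(A * \<delta>)\<^sup>2 + \<alpha> \<delta> * \<beta>2 * (h \<delta> + \<delta>) + (\<alpha> \<delta> * \<beta>2)\<^sup>2 / 4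
        \<le> (A * \<delta>)\<^sup>2 + c2 * \<delta> * \<beta>2 * (H * \<delta> + \<delta>) + (c2 * \<delta> * \<beta>2)\<^sup>2 / 4"
      using hi \<alpha>_pos' pos(2) c \<delta> h_le[OF \<delta>]
      by (intro add_mono mult_mono divide_right_mono power_mono order_refl)
         (auto simp: h_def)
    also have "\<dots> = c1 * \<delta> * \<beta>1 * (B * \<delta>)"
      using c pos(1) by (simp add: B_def power2_eq_square field_simps)
    finally show ?case using c \<delta> pos(1) by simp
  qed
  have "(\<lambda>\<delta>. norm (\<xi>s \<delta> - \<xi>\<^sub>0)) \<in> O[at_right 0](\<lambda>\<delta>. \<delta>)"
  proof (rule bigoI)
    show "\<forall>\<^sub>F \<delta> in at_right 0. norm (norm (\<xi>s \<delta> - \<xi>\<^sub>0)) \<le> B * norm \<delta>"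
      using rate eventually_at_right_less by eventually_elim simp
  qed
  moreover have "(\<lambda>\<delta>. norm (D\<alpha> (\<alpha> \<delta>) (\<xi>s \<delta>) - D \<xi>\<^sub>0)) \<in> O[at_right 0](\<lambda>\<delta>. \<delta>)"
    if L: "\<forall>a>0. L-lipschitz_on UNIV (D\<alpha> a)" for L
  proof (rule bigoI)
    show "\<forall>\<^sub>F \<delta> in at_right 0. norm (norm (D\<alpha> (\<alpha> \<delta>) (\<xi>s \<delta>) - D \<xi>\<^sub>0)) \<le> (L * B + C) * norm \<delta>"
      using rate eventually_at_right_less
    proof eventually_elim
      case (elim \<delta>)
      have lip: "L-lipschitz_on UNIV (D\<alpha> (\<alpha> \<delta>))" using L \<alpha>_pos elim(2) by blast
      have "norm (D\<alpha> (\<alpha> \<delta>) (\<xi>s \<delta>) - D \<xi>\<^sub>0)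
          \<le> norm (D\<alpha> (\<alpha> \<delta>) (\<xi>s \<delta>) - D\<alpha> (\<alpha> \<delta>) \<xi>\<^sub>0) + norm (D\<alpha> (\<alpha> \<delta>) \<xi>\<^sub>0 - D \<xi>\<^sub>0)"
        by (metis dist_norm dist_triangle)
      also have "\<dots> \<le> L * norm (\<xi>s \<delta> - \<xi>\<^sub>0) + C * \<delta>"
        using lipschitz_onD[OF lip, of "\<xi>s \<delta>" \<xi>\<^sub>0] synth_sol[OF elim(2)]
        by (simp add: dist_norm)
      also have "\<dots> \<le> L * (B * \<delta>) + C * \<delta>"
        using mult_left_mono[OF elim(1) lipschitz_on_nonneg[OF lip]] by simp
      finally show ?case using elim(2) by (simp add: algebra_simps)
    qed
  qed
  ultimately show ?thesis by blast
qed

end
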